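(* Consider the averaged conservative Keplerian spin-orbit model (coupling parameter $\chi=0$) in the $(1:1,1:1)$ resonance, linearized at the critical point $(\varphi_1,\varphi_2,J_1,J_2)=(0,0,0,0)$, that is, the (uncoupled) linear system in $(\xi_1,\xi_2,J_1,J_2)$ $$\dot\xi_1=\frac{2}{C_1}J_1,\qquad \dot\xi_2=\frac{2}{C_2}J_2,\qquad \dot J_1=-K_1\,\xi_1,\qquad \dot J_2=-L_1\,\xi_2,$$ where $$K_1=\frac{3d_1GM_2}{2a^3}\Bigl(1-\frac52e^2\Bigr),\qquad L_1=\frac{3d_2GM_1}{2a^3}\Bigl(1-\frac52e^2\Bigr).$$ If $e<\sqrt{2/5}$, then the eigenvalues of this linear system are purely imaginary.
   Context: Two homogeneous rigid ellipsoids $\mathcal E_1,\mathcal E_2$ with masses $M_1,M_2$ and principal moments of inertia $A_j\le B_j\le C_j$ ($j=1,2$) move on a Keplerian orbit with semimajor axis $a$ and eccentricity $e$; the spin axis of each body is perpendicular to the orbital plane and has the direction of its shortest physical axis. Units are normalized so that $M_1+M_2=1$, $C_1+C_2=1$ and the orbital period is $2\pi$, so that the gravitational constant is $G=a^3$. Put $d_j=B_j-A_j$; one has $0\le d_j\le C_j\le 1$. If $\theta_j$ are the rotation angles and $t$ is time, the resonant angles for the $(1:1,1:1)$ resonance are $\varphi_j=2(\theta_j-t)$. Expanding the potential to second order in $e$ and keeping only the terms that do not vanish after averaging over time, the conservative equations for $\chi=0$ are $\dot\varphi_1=\frac{2}{C_1}J_1$, $\dot\varphi_2=\frac{2}{C_2}J_2$,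 $\dot J_1=-K_1\sin\varphi_1$, $\dot J_2=-L_1\sin\varphi_2$; $\xi_j$ denotes the small displacement of $\varphi_j$ from the critical point. *)

theory Defs
  imports "HOL-Analysis.Product_Vector" "Jordan_Normal_Form.Char_Poly"
begin

text \<open>
  \<open>homogeneous_ellipsoid M A B C\<close>: \<open>A \<le> B \<le> C\<close> are the principal moments of inertia of a homogeneous
  solid ellipsoid of mass \<open>M\<close>. The moment about the axis with semi-axis \<open>p\<close> is \<open>M (q\<^sup>2 + r\<^sup>2) / 5\<close>,
  where \<open>q\<close> and \<open>r\<close> are the other two semi-axes, so that \<open>C\<close> belongs to the shortest axis, which is
  the spin axis.
\<close>

definition homogeneous_ellipsoid :: "real \<Rightarrow> real \<Rightarrow> real \<Rightarrow> real \<Rightarrow> bool" where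
  "homogeneous_ellipsoid M A B C \<longleftrightarrow>
     M > 0 \<and>
     (\<exists>p q r. p \<ge> q \<and> q \<ge> r \<and> r > 0 \<and>
        A = M * (q\<^sup>2 + r\<^sup>2) / 5 \<and> B = M * (p\<^sup>2 + r\<^sup>2) / 5 \<and> C = M * (p\<^sup>2 + q\<^sup>2) / 5)"

lemma homogeneous_ellipsoid_moments:
  assumes "homogeneous_ellipsoid M A B C"
  shows "0 < M" "0 < A" "A \<le> B" "B \<le> C"
proof -
  from assms obtain p q r where *: "M > 0" "p \<ge> q" "q \<ge> r" "r > 0"
    "A = M * (q\<^sup>2 + r\<^sup>2) / 5" "B = M * (p\<^sup>2 + r\<^sup>2) / 5" "C = M * (p\<^sup>2 + q\<^sup>2) / 5"
    unfolding homogeneous_ellipsoid_def by blast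
  have "q\<^sup>2 \<le> p\<^sup>2" "r\<^sup>2 \<le> q\<^sup>2" "0 < q\<^sup>2 + r\<^sup>2"
    using * by (auto intro!: power_mono add_nonneg_pos)
  then show "0 < M" "0 < A" "A \<le> B" "B \<le> C"
    unfolding *(5-7) using *(1) by simp_all
qed

text \<open>
  \<open>K\<^sub>1\<close> is \<open>resonance_coeff a e G d\<^sub>1 M\<^sub>2\<close> and \<open>L\<^sub>1\<close> is \<open>resonance_coeff a e G d\<^sub>2 M\<^sub>1\<close>: the last argument
  is the mass of the other body.
\<close>

definition resonance_coeff :: "real \<Rightarrow> real \<Rightarrow> real \<Rightarrow> real \<Rightarrow> real \<Rightarrow> real" where
  "resonance_coeff a e G d M = 3 * d * G * M / (2 * a ^ 3) * (1 - 5 / 2 * e\<^sup>2)"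

text \<open>
  The averaged conservative vector field in the coordinates \<open>(\<phi>\<^sub>1, \<phi>\<^sub>2, J\<^sub>1, J\<^sub>2)\<close>, and its linearization
  at the origin in the coordinates \<open>(\<xi>\<^sub>1, \<xi>\<^sub>2, J\<^sub>1, J\<^sub>2)\<close>.
\<close>

definition spin_orbit_field ::
  "real \<Rightarrow> real \<Rightarrow> real \<Rightarrow> real \<Rightarrow> real \<times> real \<times> real \<times> real \<Rightarrow> real \<times> real \<times> real \<times> real" where
  "spin_orbit_field C1 C2 K L =
     (\<lambda>(\<phi>1, \<phi>2, J1, J2). (2 / C1 * J1, 2 / C2 * J2, - K * sin \<phi>1, - L * sin \<phi>2))"

definition linear_spin_orbit_field ::
  "real \<Rightarrow> real \<Rightarrow> real \<Rightarrow> real \<Rightarrow> real \<times> real \<times> real \<times> real \<Rightarrow> real \<times> real \<times> real \<times> real" where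
  "linear_spin_orbit_field C1 C2 K L =
     (\<lambda>(\<xi>1, \<xi>2, J1, J2). (2 / C1 * J1, 2 / C2 * J2, - K * \<xi>1, - L * \<xi>2))"

definition linear_spin_orbit_mat :: "real \<Rightarrow> real \<Rightarrow> real \<Rightarrow> real \<Rightarrow> real mat" where
  "linear_spin_orbit_mat C1 C2 K L = mat_of_rows_list 4
     [[  0,   0, 2 / C1,      0],
      [  0,   0,      0, 2 / C2],
      [- K,   0,      0,      0],
      [  0, - L,      0,      0]]"

lemma spin_orbit_field_critical: "spin_orbit_field C1 C2 K L (0, 0, 0, 0) = (0, 0, 0, 0)"
  by (simp add: spin_orbit_field_def)

lemma spin_orbit_field_linearization:
  "(spin_orbit_field C1 C2 K L has_derivative linear_spin_orbit_field C1 C2 K L) (at (0, 0, 0, 0))"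
proof -
  have "((\<lambda>(\<phi>1, \<phi>2, J1, J2). (c1 * J1, c2 * J2, - K * sin \<phi>1, - L * sin \<phi>2)) has_derivative
         (\<lambda>(\<xi>1, \<xi>2, J1, J2). (c1 * J1, c2 * J2, - K * \<xi>1, - L * \<xi>2))) (at (0, 0, 0, 0))"
    for c1 c2 :: real
    unfolding case_prod_beta by (auto intro!: derivative_eq_intros simp: fun_eq_iff)
  then show ?thesis
    unfolding spin_orbit_field_def linear_spin_orbit_field_def .
qed

lemma linear_spin_orbit_mat_mult:
  assumes "linear_spin_orbit_field C1 C2 K L (\<xi>1, \<xi>2, J1, J2) = (y1, y2, y3, y4)"
  shows "linear_spin_orbit_mat C1 C2 K L *\<^sub>v vec_of_list [\<xi>1, \<xi>2, J1, J2] = vec_of_list [y1, y2, y3, y4]"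
  using assms
  by (intro eq_vecI)
     (auto simp: linear_spin_orbit_field_def linear_spin_orbit_mat_def mat_of_rows_list_def
        scalar_prod_def vec_of_list_index less_Suc_eq numeral_eq_Suc)

end

theory Submission
  imports Defs
begin

text \<open>The matrix couples coordinate 0 only with 2 and coordinate 1 only with 3, so the system
  splits into two independent oscillators. Hence an eigenvalue \<open>z\<close> has
  \<open>z\<^sup>2\<close> equal to \<open>- 2 K / C1\<close> or \<open>- 2 L / C2\<close>
  (\<open>eigenvalue_linear_spin_orbit_mat\<close>). The bound on \<open>e\<close> makes
  \<open>1 - 5 / 2 * e\<^sup>2\<close> positive, so \<open>K1\<close> and \<open>L1\<close> are
  positive multiples of \<open>d1\<close> and \<open>d2\<close>
  (\<open>resonance_coeff_pos_factor\<close>), which are nonnegative. Thus \<open>z\<^sup>2\<close>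
  is a nonpositive real and \<open>z\<close> lies on the imaginary axis
  (\<open>Re_eq_0_if_power2_nonpos\<close>); it can be 0 only if some body has
  \<open>d = 0\<close>.\<close>

lemma eigenvalue_linear_spin_orbit_mat:
  assumes "eigenvalue (map_mat complex_of_real (linear_spin_orbit_mat C1 C2 K L)) z"
  shows "z\<^sup>2 = complex_of_real (- (2 * K / C1)) \<or> z\<^sup>2 = complex_of_real (- (2 * L / C2))"
proof -
  let ?A = "map_mat complex_of_real (linear_spin_orbit_mat C1 C2 K L)"
  have dim: "dim_row ?A = 4"
    by (simp add: linear_spin_orbit_mat_def mat_of_rows_list_def)
  obtain v where v: "v \<in> carrier_vec 4" "v \<noteq> 0\<^sub>v 4" and Av: "?A *\<^sub>v v = z \<cdot>\<^sub>v v"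
    using assms dim unfolding eigenvalue_def eigenvector_def by auto
  have "(?A *\<^sub>v v) $ i = z * v $ i" if "i < 4" for i
    using Av v(1) that by simp
  from this[of 0] this[of 1] this[of 2] this[of 3] v(1)
  have eqs: "complex_of_real (2 / C1) * v $ 2 = z * v $ 0"
    "complex_of_real (2 / C2) * v $ 3 = z * v $ 1"
    "complex_of_real (- K) * v $ 0 = z * v $ 2"
    "complex_of_real (- L) * v $ 1 = z * v $ 3"
    by (auto simp: linear_spin_orbit_mat_def mat_of_rows_list_def scalar_prod_def numeral_eq_Suc)
  \<comment> \<open>One oscillator block: multiplying either equation by \<open>z\<close> and
    substituting the other gives \<open>(z\<^sup>2 - c * k) * x = 0\<close>, and likewise for
    \<open>y\<close>. Nothing is divided by \<open>z\<close>, \<open>c\<close> or \<open>k\<close>,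
    so each of them may vanish.\<close>
  have decoupled: "z\<^sup>2 = c * k"
    if "c * y = z * x" "k * x = z * y" "x \<noteq> 0 \<or> y \<noteq> 0" for c k x y :: complex
  proof -
    have "z\<^sup>2 * x = z * (c * y)" "z\<^sup>2 * y = z * (k * x)"
      by (simp_all only: that(1,2) power2_eq_square mult.assoc)
    moreover have "z * (c * y) = c * (k * x)"
      unfolding that(2) by (rule mult.left_commute)
    moreover have "z * (k * x) = k * (c * y)"
      unfolding that(1) by (rule mult.left_commute)
    ultimately have "(z\<^sup>2 - c * k) * x = 0" "(z\<^sup>2 - c * k) * y = 0"
      by (simp_all add: algebra_simps)
    then show ?thesis
      using that(3) by auto
  qed
  have "\<exists>i<4. v $ i \<noteq> 0"
    using v by (metis carrier_vecD eq_vecI index_zero_vec)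
  \<comment> \<open>The block on which the eigenvector is nonzero decides which alternative
    holds.\<close>
  then have "(v $ 0 \<noteq> 0 \<or> v $ 2 \<noteq> 0) \<or> (v $ 1 \<noteq> 0 \<or> v $ 3 \<noteq> 0)"
    by (auto simp: less_Suc_eq numeral_eq_Suc)
  then show ?thesis
    using decoupled[OF eqs(1,3)] decoupled[OF eqs(2,4)] by auto
qed

text \<open>The imaginary part of \<open>z\<^sup>2\<close> is \<open>2 * Re z * Im z\<close>, which
  must vanish; and if \<open>Im z = 0\<close>, then
  \<open>(Re z)\<^sup>2 = r \<le> 0\<close>.\<close>

lemma Re_eq_0_if_power2_nonpos:
  assumes "z\<^sup>2 = complex_of_real r" "r \<le> 0"
  shows "Re z = 0"
proof -
  have "Im z = 0 \<Longrightarrow> (Re z)\<^sup>2 \<le> 0" and "Re z * Im z = 0"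
    using assms by (auto simp: complex_eq_iff power2_eq_square)
  then show ?thesis by auto
qed

text \<open>The normalization \<open>G = a ^ 3\<close> cancels the semimajor axis. The factor
  \<open>c\<close> does not depend on \<open>d\<close>, so the coefficient has the sign of
  \<open>d\<close> and vanishes exactly when \<open>d\<close> does.\<close>

lemma resonance_coeff_pos_factor:
  assumes "a > 0" "G = a ^ 3" "M > 0" "0 \<le> e" "e < sqrt (2 / 5)"
  obtains c where "c > 0" "\<And>d. resonance_coeff a e G d M = c * d"
proof
  have "e\<^sup>2 < (sqrt (2 / 5))\<^sup>2"
    using assms by (intro power_strict_mono) auto
  then show "3 * M / 2 * (1 - 5 / 2 * e\<^sup>2) > 0"
    using assms by simp
  show "resonance_coeff a e G d M = 3 * M / 2 * (1 - 5 / 2 * e\<^sup>2) * d" for d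
    using assms by (simp add: resonance_coeff_def)
qed

theorem proposition4:
  fixes M1 M2 A1 B1 C1 A2 B2 C2 a e G d1 d2 K1 L1 :: real
  assumes "homogeneous_ellipsoid M1 A1 B1 C1"
    and "homogeneous_ellipsoid M2 A2 B2 C2"
    and "M1 + M2 = 1"
    and "C1 + C2 = 1"
    and "a > 0"
    and "G = a ^ 3"
    and "d1 = B1 - A1"
    and "d2 = B2 - A2"
    and "K1 = resonance_coeff a e G d1 M2"
    and "L1 = resonance_coeff a e G d2 M1"
    and "0 \<le> e"
    and "e < sqrt (2 / 5)"
  shows "\<forall>z. eigenvalue (map_mat complex_of_real (linear_spin_orbit_mat C1 C2 K1 L1)) z \<longrightarrow>
           Re z = 0 \<and> (z = 0 \<longrightarrow> d1 = 0 \<or> d2 = 0)"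
proof (intro allI impI)
  fix z
  assume "eigenvalue (map_mat complex_of_real (linear_spin_orbit_mat C1 C2 K1 L1)) z"
  note z = eigenvalue_linear_spin_orbit_mat[OF this]
  note m1 = homogeneous_ellipsoid_moments[OF assms(1)]
  note m2 = homogeneous_ellipsoid_moments[OF assms(2)]
  obtain c1 where c1: "c1 > 0" "K1 = c1 * d1"
    using resonance_coeff_pos_factor[of a G M2 e] m2(1) assms by metis
  obtain c2 where c2: "c2 > 0" "L1 = c2 * d2"
    using resonance_coeff_pos_factor[of a G M1 e] m1(1) assms by metis
  have C: "C1 > 0" "C2 > 0"
    using m1 m2 by linarith+
  have "0 \<le> d1" "0 \<le> d2"
    using m1 m2 assms by simp_all
  then have "- (2 * K1 / C1) \<le> 0" "- (2 * L1 / C2) \<le> 0"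
    using c1 c2 C by simp_all
  then have "Re z = 0"
    using z Re_eq_0_if_power2_nonpos by blast
  \<comment> \<open>For \<open>z = 0\<close> one of the two values of \<open>z\<^sup>2\<close> is 0,
    which forces the matching \<open>d\<close> to vanish because \<open>c1\<close>,
    \<open>c2\<close>, \<open>C1\<close> and \<open>C2\<close> are positive.\<close>
  moreover have "d1 = 0 \<or> d2 = 0" if "z = 0"
    using z that c1 c2 C by auto
  ultimately show "Re z = 0 \<and> (z = 0 \<longrightarrow> d1 = 0 \<or> d2 = 0)"
    by blast
qed

end
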